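(* For all nonnegative integers $n,m,k$, $$\det\left(q^{\binom{i-j+m}{2}}\begin{bmatrix}k+i+j+m\\ i-j+m\end{bmatrix}\right)_{i,j=0}^{n-1}=q^{n\binom{m}{2}}\prod_{j=1}^{n}\frac{\prod_{\ell=0}^{2m-1}[2j-1+k+\ell]}{\prod_{\ell=0}^{m-1}[j+\ell]\,[j+k+m+\ell]}=\det\left(C_{n-i+j}^{(2i+k+1)}(q)\right)_{i,j=0}^{m-1}.$$
   Context: $q$ is an indeterminate, $[a]=\frac{1-q^a}{1-q}$, $(q;q)_a=\prod_{l=1}^a(1-q^l)$, and for integers $a\ge0$, $b$, $\begin{bmatrix}a\\ b\end{bmatrix}=\frac{(q;q)_a}{(q;q)_b(q;q)_{a-b}}$ if $0\le b\le a$ and $0$ otherwise; $\binom{a}{2}=a(a-1)/2$ for any integer $a$. For a positive integer $r$ and integer $\ell$, $C_\ell^{(r)}(q)=\frac{[r]}{[2\ell+r]}\begin{bmatrix}2\ell+r\\ \ell\end{bmatrix}$ if $\ell\ge0$ and $C_\ell^{(r)}(q)=0$ if $\ell<0$. Empty products and $0\times0$ determinants equal $1$. *)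

theory Defs
  imports "HOL-Computational_Algebra.Fraction_Field" "HOL-Computational_Algebra.Polynomial"
    "Jordan_Normal_Form.Determinant"
begin

text \<open>The notions below take the value of \<open>q\<close> as a parameter in an arbitrary field; the
  indeterminate itself is the generator \<open>qq\<close> of the field of rational functions over the
  rationals.\<close>

definition qq :: "rat poly fract" where
  "qq = Fract [:0, 1:] 1"

definition qint :: "'a::field \<Rightarrow> nat \<Rightarrow> 'a" where
  "qint q a = (1 - q ^ a) / (1 - q)"

definition qpoch :: "'a::field \<Rightarrow> nat \<Rightarrow> 'a" where
  "qpoch q a = (\<Prod>l=1..a. 1 - q ^ l)"

definition qbinom :: "'a::field \<Rightarrow> nat \<Rightarrow> int \<Rightarrow> 'a" where
  "qbinom q a b =
     (if 0 \<le> b \<and> b \<le> int a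
      then qpoch q a / (qpoch q (nat b) * qpoch q (nat (int a - b)))
      else 0)"

text \<open>The division is exact, also for negative arguments, and the value is never negative.\<close>

definition binom2 :: "int \<Rightarrow> int" where
  "binom2 a = a * (a - 1) div 2"

definition qcatalan :: "'a::field \<Rightarrow> nat \<Rightarrow> int \<Rightarrow> 'a" where
  "qcatalan q r l =
     (if 0 \<le> l
      then qint q r / qint q (2 * nat l + r) * qbinom q (2 * nat l + r) l
      else 0)"

end

theory Submission imports Defs "Jordan_Normal_Form.Char_Poly" begin

text \<open>Dodgson condensation. Write \<open>D(n,m,k)\<close> and \<open>E(n,m,k)\<close> for the two determinants and
  \<open>P(n,m,k)\<close> for the product. Shifting the row or column index in either matrix only changes the
  parameters \<open>n\<close>, \<open>m\<close>, \<open>k\<close>, so the Desnanot--Jacobi identity for \<open>D(n+1,m,k)\<close>, as well as the one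
  for \<open>E(n,m+1,k)\<close>, becomes the same relation
  \<open>X(n+1,m,k) X(n-1,m,k+2) + X(n,m+1,k) X(n,m-1,k+2) = X(n,m,k) X(n,m,k+2)\<close>.
  For \<open>X = P\<close>, dividing by the right-hand side reduces it to
  \<open>[n][n+k+1+2m] + q^n [m][m+k+1] = [n+m][n+m+k+1]\<close>. As \<open>P\<close> never vanishes, the relation determines
  \<open>D\<close> by induction on \<open>n\<close> and \<open>E\<close> by induction on \<open>m\<close>.\<close>

section \<open>The Desnanot--Jacobi identity over an integral domain\<close>

lemma det_mat_single_entry_column:
  fixes A :: "'a::comm_ring_1 mat"
  assumes A: "A \<in> carrier_mat n n" and j: "j < n"
    and col: "\<And>i. i < n \<Longrightarrow> A $$ (i, j) = (if i = j then d else 0)"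
  shows "det A = d * det (mat_delete A j j)"
proof -
  have "det A = (\<Sum>i<n. A $$ (i, j) * cofactor A i j)"
    by (rule laplace_expansion_column[OF A j])
  also have "\<dots> = (\<Sum>i<n. if i = j then d * cofactor A j j else 0)"
    by (intro sum.cong) (auto simp: col)
  also have "\<dots> = d * cofactor A j j" using j by simp
  finally show ?thesis by (simp add: cofactor_def)
qed

text \<open>Replacing the first and last columns of the identity matrix by those of the adjugate of \<open>A\<close>
  gives a matrix \<open>B\<close> whose determinant is a two by two minor of the adjugate; the corresponding
  columns of \<open>A B\<close> are multiples of unit vectors, hence \<open>det (A B) = (det A)^2\<close> times the
  interior minor.\<close>

lemma desnanot_jacobi_nonsingular:
  fixes f :: "nat \<Rightarrow> nat \<Rightarrow> 'a::idom"
  assumes nz: "det (mat (Suc (Suc n)) (Suc (Suc n)) (\<lambda>(i, j). f i j)) \<noteq> 0"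
  shows "det (mat (Suc (Suc n)) (Suc (Suc n)) (\<lambda>(i, j). f i j)) * det (mat n n (\<lambda>(i, j). f (Suc i) (Suc j)))
    = det (mat (Suc n) (Suc n) (\<lambda>(i, j). f i j)) * det (mat (Suc n) (Suc n) (\<lambda>(i, j). f (Suc i) (Suc j)))
    - det (mat (Suc n) (Suc n) (\<lambda>(i, j). f (Suc i) j)) * det (mat (Suc n) (Suc n) (\<lambda>(i, j). f i (Suc j)))"
proof -
  define N where "N = Suc (Suc n)"
  define A where "A = mat N N (\<lambda>(i, j). f i j)"
  define B where "B = mat N N (\<lambda>(i, j). if j = 0 \<or> j = Suc n then adj_mat A $$ (i, j) else if i = j then 1 else 0)"
  define C where "C = mat N N (\<lambda>(i, j). if j = 0 \<or> j = Suc n then (if i = j then det A else 0) else f i j)"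
  have cA: "A \<in> carrier_mat N N" and cB: "B \<in> carrier_mat N N" and cC: "C \<in> carrier_mat N N"
    by (simp_all add: A_def B_def C_def)
  note adj = adj_mat[OF cA]
  have AB: "A * B = C"
  proof (rule eq_matI)
    fix i j assume "i < dim_row C" "j < dim_col C"
    then have i: "i < N" and j: "j < N" by (simp_all add: C_def)
    have AB: "(A * B) $$ (i, j) = (\<Sum>l<N. A $$ (i, l) * B $$ (l, j))"
      using i j cA cB by (auto simp: scalar_prod_def lessThan_atLeast0)
    show "(A * B) $$ (i, j) = C $$ (i, j)"
    proof (cases "j = 0 \<or> j = Suc n")
      case True
      then have "(A * B) $$ (i, j) = (A * adj_mat A) $$ (i, j)"
        unfolding AB using i j cA adj(1)
        by (auto simp: scalar_prod_def lessThan_atLeast0 B_def intro!: sum.cong)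
      also have "\<dots> = C $$ (i, j)"
        using True i j by (auto simp: adj(2) C_def)
      finally show ?thesis .
    next
      case False
      then have "(A * B) $$ (i, j) = (\<Sum>l<N. if l = j then A $$ (i, l) else 0)"
        unfolding AB using j by (intro sum.cong) (auto simp: B_def)
      also have "\<dots> = C $$ (i, j)"
        using False i j by (auto simp: C_def A_def)
      finally show ?thesis .
    qed
  qed (use cA cB cC in auto)
  have del: "det (mat_delete A 0 0) = det (mat (Suc n) (Suc n) (\<lambda>(i, j). f (Suc i) (Suc j)))"
    "det (mat_delete A (Suc n) (Suc n)) = det (mat (Suc n) (Suc n) (\<lambda>(i, j). f i j))"
    "det (mat_delete A 0 (Suc n)) = det (mat (Suc n) (Suc n) (\<lambda>(i, j). f (Suc i) j))"
    "det (mat_delete A (Suc n) 0) = det (mat (Suc n) (Suc n) (\<lambda>(i, j). f i (Suc j)))"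
    by (auto intro!: arg_cong[of _ _ det] eq_matI simp: mat_delete_def A_def N_def)
  have "det C = det A * det (mat_delete C 0 0)"
    by (rule det_mat_single_entry_column[OF cC]) (auto simp: C_def N_def)
  also have "det (mat_delete C 0 0) = det A * det (mat_delete (mat_delete C 0 0) n n)"
    by (rule det_mat_single_entry_column[where n = "Suc n"])
       (auto simp: C_def N_def mat_delete_def)
  also have "mat_delete (mat_delete C 0 0) n n = mat n n (\<lambda>(i, j). f (Suc i) (Suc j))"
    by (auto simp: C_def N_def mat_delete_def intro!: eq_matI)
  finally have detC: "det C = det A * (det A * det (mat n n (\<lambda>(i, j). f (Suc i) (Suc j))))" .
  have adjv: "adj_mat A $$ (i, j) = cofactor A j i" if "i < N" "j < N" for i j
    using that cA by (auto simp: adj_mat_def)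
  have "det B = (\<Sum>j<N. B $$ (0, j) * cofactor B 0 j)"
    by (rule laplace_expansion_row[OF cB]) (simp add: N_def)
  also have "\<dots> = B $$ (0, 0) * cofactor B 0 0 + B $$ (0, Suc n) * cofactor B 0 (Suc n)"
  proof -
    have "(\<Sum>j<n. B $$ (0, Suc j) * cofactor B 0 (Suc j)) = 0"
      by (intro sum.neutral) (auto simp: B_def N_def)
    then show ?thesis
      unfolding N_def by (subst sum.lessThan_Suc_shift) simp
  qed
  \<comment> \<open>Without row and column 0, \<open>B\<close> is the identity except in its last
    column, hence upper triangular.\<close>
  also have "cofactor B 0 0 = cofactor A (Suc n) (Suc n)"
  proof -
    let ?M = "mat_delete B 0 0"
    have "det ?M = prod_list (diag_mat ?M)"
      by (rule det_upper_triangular[where n = "Suc n"])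
         (auto simp: B_def N_def mat_delete_def upper_triangular_def)
    also have "\<dots> = (\<Prod>i<Suc n. ?M $$ (i, i))"
      by (simp add: prod_list_diag_prod B_def N_def lessThan_atLeast0)
    also have "\<dots> = ?M $$ (n, n) * (\<Prod>i<n. 1)"
      by (auto simp: B_def N_def mat_delete_def)
    also have "\<dots> = cofactor A (Suc n) (Suc n)"
      using adjv[of "Suc n" "Suc n"] by (auto simp: B_def N_def mat_delete_def)
    finally show ?thesis by (simp add: cofactor_def)
  qed
  \<comment> \<open>The last row of this minor is nonzero at most in column 0, and expanding along
    it leaves an identity matrix. The signs \<open>(-1) ^ (n + 1)\<close> and
    \<open>(-1) ^ n\<close> combine to -1.\<close>
  also have "cofactor B 0 (Suc n) = - cofactor A 0 (Suc n)"
  proof -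
    let ?M = "mat_delete B 0 (Suc n)"
    have "det ?M = (\<Sum>j<Suc n. ?M $$ (n, j) * cofactor ?M n j)"
      by (rule laplace_expansion_row) (auto simp: B_def N_def mat_delete_def)
    also have "\<dots> = ?M $$ (n, 0) * cofactor ?M n 0"
      by (subst sum.lessThan_Suc_shift) (auto simp: B_def N_def mat_delete_def intro!: sum.neutral)
    also have "mat_delete ?M n 0 = 1\<^sub>m n"
      by (auto simp: B_def N_def mat_delete_def intro!: eq_matI)
    then have "cofactor ?M n 0 = (-1) ^ n" by (simp add: cofactor_def)
    also have "?M $$ (n, 0) = cofactor A 0 (Suc n)"
      using adjv[of "Suc n" 0] by (auto simp: B_def N_def mat_delete_def)
    finally show ?thesis
      by (simp add: cofactor_def[of B] power_add[symmetric] mult.assoc[symmetric])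
  qed
  finally have detB: "det B = det (mat_delete A 0 0) * det (mat_delete A (Suc n) (Suc n))
      - det (mat_delete A 0 (Suc n)) * det (mat_delete A (Suc n) 0)"
    using adjv[of 0 0] adjv[of 0 "Suc n"]
    by (simp add: B_def N_def cofactor_def power_add[symmetric])
  have "det A * det B = det C" using det_mult[OF cA cB] AB by simp
  \<comment> \<open>One of the two factors \<open>det A\<close> in \<open>det C\<close> cancels;
    this is where nonsingularity enters.\<close>
  then have "det B = det A * det (mat n n (\<lambda>(i, j). f (Suc i) (Suc j)))"
    unfolding detC using nz by (simp add: A_def N_def)
  then show ?thesis
    unfolding detB del by (simp add: A_def N_def mult.commute)
qed

text \<open>The nonsingular case applies to \<open>A + x I\<close>, whose determinant is monic in \<open>x\<close>;
  then put \<open>x = 0\<close>.\<close>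

theorem desnanot_jacobi:
  fixes f :: "nat \<Rightarrow> nat \<Rightarrow> 'a::idom"
  shows "det (mat (Suc (Suc n)) (Suc (Suc n)) (\<lambda>(i, j). f i j)) * det (mat n n (\<lambda>(i, j). f (Suc i) (Suc j)))
    = det (mat (Suc n) (Suc n) (\<lambda>(i, j). f i j)) * det (mat (Suc n) (Suc n) (\<lambda>(i, j). f (Suc i) (Suc j)))
    - det (mat (Suc n) (Suc n) (\<lambda>(i, j). f (Suc i) j)) * det (mat (Suc n) (Suc n) (\<lambda>(i, j). f i (Suc j)))"
proof -
  let ?N = "Suc (Suc n)"
  define g where "g i j = [:f i j, if i = j then 1 else 0:]" for i j
  \<comment> \<open>Negating the entries turns the characteristic matrix \<open>x I - M\<close> into
    \<open>x I + A\<close>, so monicity of the characteristic polynomial gives a nonzero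
    determinant.\<close>
  have "mat ?N ?N (\<lambda>(i, j). g i j) = char_poly_matrix (mat ?N ?N (\<lambda>(i, j). - f i j))"
    by (auto simp: char_poly_matrix_def g_def intro!: eq_matI)
  then have "det (mat ?N ?N (\<lambda>(i, j). g i j)) = char_poly (mat ?N ?N (\<lambda>(i, j). - f i j))"
    by (simp add: char_poly_def)
  also have "\<dots> \<noteq> 0"
    using degree_monic_char_poly[of "mat ?N ?N (\<lambda>(i, j). - f i j)" ?N] by auto
  finally have "det (mat ?N ?N (\<lambda>(i, j). g i j)) \<noteq> 0" .
  note eq = arg_cong[OF desnanot_jacobi_nonsingular[OF this], where f = "\<lambda>p. poly p 0"]
  have ev: "poly (det (mat l l (\<lambda>(i, j). g (r i) (s j)))) 0 = det (mat l l (\<lambda>(i, j). f (r i) (s j)))" for l r s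
    by (rule poly_det_cong[where n = l]) (auto simp: g_def)
  note ev0 = ev[of _ id id, simplified] ev[of _ Suc id, simplified] ev[of _ id Suc, simplified] ev[of _ Suc Suc, simplified]
  show ?thesis using eq by (simp only: poly_mult poly_diff ev0)
qed

section \<open>Auxiliary products and the closed product formula\<close>

lemma prod_shift_cross:
  fixes f :: "nat \<Rightarrow> 'a::comm_monoid_mult"
  shows "(\<Prod>l<m. f (Suc l)) * f 0 = (\<Prod>l<m. f l) * f m"
  by (metis prod.lessThan_Suc prod.lessThan_Suc_shift mult.commute)

lemma prod_lessThan_double:
  fixes f :: "nat \<Rightarrow> 'a::comm_monoid_mult"
  shows "(\<Prod>l<2 * m. f l) = (\<Prod>l<m. f l) * (\<Prod>l<m. f (m + l))"
proof -
  have "(\<Prod>l<m + r. f l) = (\<Prod>l<m. f l) * (\<Prod>l<r. f (m + l))" for r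
    by (induction r) (simp_all add: mult.assoc)
  then show ?thesis by (simp add: mult_2)
qed

lemma binom2_int: "binom2 (int m) = int (m choose 2)"
  by (cases m) (simp_all add: binom2_def choose_two zdiv_int algebra_simps)

text \<open>The second difference of the exponent is 1; this yields the extra \<open>q\<close> in
  each induction step of \<open>closed_form_ratio_middle\<close>.\<close>

lemma choose_two_second_difference:
  "(Suc (Suc m) choose 2) + (m choose 2) = Suc (2 * (Suc m choose 2))"
  by (simp add: numeral_2_eq_2)

text \<open>Indexed from 0: this is the factor of the theorem at \<open>j + 1\<close>, so
  \<open>2*j - 1\<close> turns into \<open>2 * j + 1\<close> and no subtraction on naturals
  remains.\<close>

definition closed_form_factor :: "'a::field \<Rightarrow> nat \<Rightarrow> nat \<Rightarrow> nat \<Rightarrow> 'a" where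
  "closed_form_factor q j m k = (\<Prod>l<2 * m. qint q (2 * j + 1 + k + l)) /
     (\<Prod>l<m. qint q (Suc j + l) * qint q (Suc j + k + m + l))"

definition closed_form :: "'a::field \<Rightarrow> nat \<Rightarrow> nat \<Rightarrow> nat \<Rightarrow> 'a" where
  "closed_form q n m k = q ^ (n * (m choose 2)) * (\<Prod>j<n. closed_form_factor q j m k)"

lemma closed_form_0 [simp]: "closed_form q 0 m k = 1" "closed_form q n 0 k = 1"
  by (simp_all add: closed_form_def closed_form_factor_def numeral_2_eq_2)

lemma closed_form_Suc:
  "closed_form q (Suc n) m k = closed_form q n m k * (q ^ (m choose 2) * closed_form_factor q n m k)"
  by (simp add: closed_form_def power_add algebra_simps)

text \<open>These two properties of the indeterminate make every denominator below nonzero.\<close>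

locale generic_q =
  fixes q :: "'a::field"
  assumes q_nonzero: "q \<noteq> 0"
    and not_root_of_unity: "0 < a \<Longrightarrow> q ^ a \<noteq> 1"
begin

section \<open>Nonvanishing and the recurrence of the product formula\<close>

lemma qint_nonzero [simp]: "0 < a \<Longrightarrow> qint q a \<noteq> 0"
  using not_root_of_unity[of a] not_root_of_unity[of 1] by (simp add: qint_def)

lemma one_minus_q: "1 - q \<noteq> 0"
  using not_root_of_unity[of 1] by simp

lemma qpoch_0 [simp]: "qpoch q 0 = 1"
  by (simp add: qpoch_def)

lemma qpoch_Suc: "qpoch q (Suc a) = qpoch q a * (1 - q ^ Suc a)"
  by (simp add: qpoch_def)

lemma qpoch_nonzero [simp]: "qpoch q a \<noteq> 0"
  using not_root_of_unity by (auto simp: qpoch_def)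

lemma closed_form_factor_nonzero [simp]: "closed_form_factor q j m k \<noteq> 0"
  by (simp add: closed_form_factor_def)

lemma closed_form_nonzero [simp]: "closed_form q n m k \<noteq> 0"
  by (simp add: closed_form_def q_nonzero)

text \<open>Passing from \<open>(j + 1, k)\<close> to \<open>(j, k + 2)\<close> keeps the numerator;
  only the two denominator windows slide by one place, so each contributes a quotient of two end
  factors.\<close>

lemma closed_form_factor_Suc_left:
  "closed_form_factor q (Suc j) m k * (qint q (j + 1 + m) * qint q (j + 2 + k + m))
    = closed_form_factor q j m (k + 2) * (qint q (j + 1) * qint q (j + 2 + k + 2 * m))"
proof -
  define N where "N = (\<Prod>l<2 * m. qint q (2 * j + 3 + k + l))"
  define a where "a = (\<Prod>l<m. qint q (j + 1 + l))"
  define a' where "a' = (\<Prod>l<m. qint q (j + 2 + l))"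
  define b where "b = (\<Prod>l<m. qint q (j + 2 + k + m + l))"
  define b' where "b' = (\<Prod>l<m. qint q (j + 3 + k + m + l))"
  have nz: "a \<noteq> 0" "a' \<noteq> 0" "b \<noteq> 0" "b' \<noteq> 0"
    by (simp_all add: a_def a'_def b_def b'_def)
  have "a' * qint q (j + 1) = a * qint q (j + 1 + m)"
    using prod_shift_cross[of "\<lambda>l. qint q (j + 1 + l)" m] by (simp add: a_def a'_def)
  moreover have "b' * qint q (j + 2 + k + m) = b * qint q (j + 2 + k + 2 * m)"
    using prod_shift_cross[of "\<lambda>l. qint q (j + 2 + k + m + l)" m]
    by (simp add: b_def b'_def eval_nat_numeral add_ac)
  moreover have "closed_form_factor q (Suc j) m k = N / (a' * b)"
    by (simp add: closed_form_factor_def N_def a'_def b_def prod.distrib eval_nat_numeral)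
  moreover have "closed_form_factor q j m (k + 2) = N / (a * b')"
    by (simp add: closed_form_factor_def N_def a_def b'_def prod.distrib eval_nat_numeral add_ac)
  ultimately show ?thesis
    using nz by (simp add: divide_simps) Groebner_Basis.algebra
qed

text \<open>Raising \<open>m\<close> appends two factors to the numerator and one to the first
  denominator window; the second window loses its first factor and gains two at the end.\<close>

lemma closed_form_factor_Suc_middle:
  "closed_form_factor q j (Suc m) k
      * (qint q (j + 1 + m) * qint q (j + 1 + k + 2 * m) * qint q (j + 2 + k + 2 * m))
    = closed_form_factor q j m k
      * (qint q (2 * j + 1 + k + 2 * m) * qint q (2 * j + 2 + k + 2 * m) * qint q (j + 1 + k + m))"
proof -
  define N where "N = (\<Prod>l<2 * m. qint q (2 * j + 1 + k + l))"
  define a where "a = (\<Prod>l<m. qint q (j + 1 + l))"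
  define b where "b = (\<Prod>l<m. qint q (j + 1 + k + m + l))"
  define b' where "b' = (\<Prod>l<Suc m. qint q (j + 2 + k + m + l))"
  have nz: "a \<noteq> 0" "b \<noteq> 0" "b' \<noteq> 0"
    by (simp_all add: a_def b_def b'_def del: prod.lessThan_Suc)
  have "b' * qint q (j + 1 + k + m)
      = b * qint q (j + 1 + k + 2 * m) * qint q (j + 2 + k + 2 * m)"
    using prod_shift_cross[of "\<lambda>l. qint q (j + 1 + k + m + l)" "Suc m"]
    by (simp add: b_def b'_def eval_nat_numeral add_ac)
  moreover have "closed_form_factor q j m k = N / (a * b)"
    by (simp add: closed_form_factor_def N_def a_def b_def prod.distrib)
  moreover have "closed_form_factor q j (Suc m) k
      = N * (qint q (2 * j + 1 + k + 2 * m) * qint q (2 * j + 2 + k + 2 * m))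
        / (a * qint q (j + 1 + m) * b')"
    by (simp add: closed_form_factor_def N_def a_def b'_def prod.distrib add_ac mult_ac)
  ultimately have "closed_form_factor q j (Suc m) k
        * (qint q (j + 1 + m) * qint q (j + 1 + k + 2 * m) * qint q (j + 2 + k + 2 * m)) * b'
      = closed_form_factor q j m k
        * (qint q (2 * j + 1 + k + 2 * m) * qint q (2 * j + 2 + k + 2 * m) * qint q (j + 1 + k + m)) * b'"
    using nz by (simp add: divide_simps) Groebner_Basis.algebra
  then show ?thesis using nz by simp
qed

text \<open>All but the last factors of the longer products match, so the quotient reduces to
  \<open>closed_form_factor_Suc_left\<close>.\<close>

lemma closed_form_ratio_left:
  "closed_form q (Suc (Suc n)) m k * closed_form q n m (k + 2)
      * (qint q (n + 1 + m) * qint q (n + 2 + k + m))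
    = closed_form q (Suc n) m k * closed_form q (Suc n) m (k + 2)
      * (qint q (n + 1) * qint q (n + 2 + k + 2 * m))"
proof -
  have "(x * (c * r)) * y * e = x * (y * (c * r')) * e'" if "r * e = r' * e'"
    for x y c r r' e e' :: 'a
    using that by Groebner_Basis.algebra
  from this[OF closed_form_factor_Suc_left] show ?thesis
    unfolding closed_form_Suc[of q "Suc n" m k] closed_form_Suc[of q n m "k + 2"] .
qed

lemma closed_form_ratio_middle:
  "closed_form q n (Suc (Suc m)) k * closed_form q n m (k + 2)
      * (qint q (n + m + 1) * qint q (n + k + m + 2))
    = closed_form q n (Suc m) k * closed_form q n (Suc m) (k + 2)
      * (q ^ n * qint q (m + 1) * qint q (k + m + 2))"
proof (induction n)
  case 0
  then show ?case by (simp add: add_ac)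
next
  case (Suc n)
  \<comment> \<open>\<open>c\<close> and \<open>d\<close> arise identically from the parameters
    \<open>(Suc m, k)\<close> and \<open>(m, k + 2)\<close>, since \<open>k + 2 * m\<close> grows by
    2 in both cases; hence they cancel.\<close>
  define c where "c = qint q (2 * n + k + 2 * m + 3) * qint q (2 * n + k + 2 * m + 4)"
  define d where "d = qint q (n + k + 2 * m + 3) * qint q (n + k + 2 * m + 4)"
  have nz: "c \<noteq> 0" "d \<noteq> 0" by (simp_all add: c_def d_def)
  have "closed_form_factor q n (Suc (Suc m)) k * (qint q (n + m + 2) * d)
      = closed_form_factor q n (Suc m) k * (c * qint q (n + k + m + 2))"
    using closed_form_factor_Suc_middle[of n "Suc m" k]
    by (simp add: c_def d_def eval_nat_numeral add_ac mult_ac)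
  moreover have "closed_form_factor q n (Suc m) (k + 2) * (qint q (n + m + 1) * d)
      = closed_form_factor q n m (k + 2) * (c * qint q (n + k + m + 3))"
    using closed_form_factor_Suc_middle[of n m "k + 2"]
    by (simp add: c_def d_def eval_nat_numeral add_ac mult_ac)
  ultimately have "closed_form_factor q n (Suc (Suc m)) k * closed_form_factor q n m (k + 2)
        * (qint q (n + m + 2) * qint q (n + k + m + 3)) * (c * d)
      = closed_form_factor q n (Suc m) k * closed_form_factor q n (Suc m) (k + 2)
        * (qint q (n + m + 1) * qint q (n + k + m + 2)) * (c * d)"
    by Groebner_Basis.algebra
  then have "closed_form_factor q n (Suc (Suc m)) k * closed_form_factor q n m (k + 2)
        * (qint q (n + m + 2) * qint q (n + k + m + 3))
      = closed_form_factor q n (Suc m) k * closed_form_factor q n (Suc m) (k + 2)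
        * (qint q (n + m + 1) * qint q (n + k + m + 2))"
    using nz by simp
  moreover have "q ^ (Suc (Suc m) choose 2) * q ^ (m choose 2)
      = q * (q ^ (Suc m choose 2) * q ^ (Suc m choose 2))"
    by (simp only: power_add[symmetric] choose_two_second_difference) (simp add: mult_2)
  \<comment> \<open>The bookkeeping of the induction step as a polynomial implication:
    \<open>A\<close> is eliminated by substitution, without division.\<close>
  moreover have "F * (C'' * R) * (F' * (C * R')) * A' = G * (C' * S) * (G' * (C' * S')) * (q * Q * x * y)"
    if "R * R' * A' = S * S' * A" "C'' * C = q * (C' * C')" "F * F' * A = G * G' * (Q * x * y)"
    for F F' G G' R R' S S' A A' C C' C'' Q x y :: 'a
    using that by Groebner_Basis.algebra
  ultimately have *: "closed_form q (Suc n) (Suc (Suc m)) k * closed_form q (Suc n) m (k + 2)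
      * (qint q (n + m + 2) * qint q (n + k + m + 3))
    = closed_form q (Suc n) (Suc m) k * closed_form q (Suc n) (Suc m) (k + 2)
      * (q * q ^ n * qint q (m + 1) * qint q (k + m + 2))"
    unfolding closed_form_Suc using Suc by blast
  then show ?case by (simp add: eval_nat_numeral add_ac)
qed

text \<open>The q-analogue of
  \<open>b (b + c) + a (a + 2 b + c) = (a + b) (a + b + c)\<close>.\<close>

lemma qint_product_identity:
  "q ^ a * qint q b * qint q (b + c) + qint q a * qint q (a + 2 * b + c)
    = qint q (a + b) * qint q (a + b + c)"
  using one_minus_q by (simp add: qint_def divide_simps power_add mult_2) Groebner_Basis.algebra

lemma closed_form_recurrence:
  "closed_form q (Suc (Suc n)) (Suc m) k * closed_form q n (Suc m) (k + 2)
      + closed_form q (Suc n) (Suc (Suc m)) k * closed_form q (Suc n) m (k + 2)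
    = closed_form q (Suc n) (Suc m) k * closed_form q (Suc n) (Suc m) (k + 2)"
proof -
  \<comment> \<open>The common denominator of both ratios, and also the right-hand side of
    \<open>qint_product_identity\<close> at \<open>a = n + 1\<close>, \<open>b = m + 1\<close>,
    \<open>c = k + 1\<close>.\<close>
  define e where "e = qint q (n + m + 2) * qint q (n + m + k + 3)"
  have "e \<noteq> 0" by (simp add: e_def)
  moreover have "closed_form q (Suc (Suc n)) (Suc m) k * closed_form q n (Suc m) (k + 2) * e
    = closed_form q (Suc n) (Suc m) k * closed_form q (Suc n) (Suc m) (k + 2)
      * (qint q (n + 1) * qint q (n + k + 2 * m + 4))"
    using closed_form_ratio_left[of n "Suc m" k] by (simp add: e_def eval_nat_numeral add_ac)
  moreover have "closed_form q (Suc n) (Suc (Suc m)) k * closed_form q (Suc n) m (k + 2) * e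
    = closed_form q (Suc n) (Suc m) k * closed_form q (Suc n) (Suc m) (k + 2)
      * (q ^ (n + 1) * qint q (m + 1) * qint q (k + m + 2))"
    using closed_form_ratio_middle[of "Suc n" m k] by (simp add: e_def eval_nat_numeral add_ac)
  moreover have "q ^ (n + 1) * qint q (m + 1) * qint q (k + m + 2)
      + qint q (n + 1) * qint q (n + k + 2 * m + 4) = e"
    using qint_product_identity[of "n + 1" "m + 1" "k + 1"]
    by (simp add: e_def eval_nat_numeral add_ac)
  moreover have "(x + y) * e = z * e" if "x * e = z * a" "y * e = z * b" "b + a = e"
    for x y z a b :: 'a
    using that by Groebner_Basis.algebra
  ultimately have "(closed_form q (Suc (Suc n)) (Suc m) k * closed_form q n (Suc m) (k + 2)
      + closed_form q (Suc n) (Suc (Suc m)) k * closed_form q (Suc n) m (k + 2)) * e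
    = closed_form q (Suc n) (Suc m) k * closed_form q (Suc n) (Suc m) (k + 2) * e"
    by blast
  with \<open>e \<noteq> 0\<close> show ?thesis by simp
qed

section \<open>q-binomials and q-Catalan numbers as the determinants of size one\<close>

lemma qpoch_add: "qpoch q (k + m) = qpoch q k * (\<Prod>l<m. 1 - q ^ (Suc k + l))"
  by (induction m) (simp_all add: qpoch_Suc)

lemma prod_qint: "(\<Prod>l<m. qint q (f l)) = (\<Prod>l<m. 1 - q ^ f l) / (1 - q) ^ m"
  by (simp add: qint_def prod_dividef)

lemma qbinom_int:
  "b \<le> a \<Longrightarrow> qbinom q a (int b) = qpoch q a / (qpoch q b * qpoch q (a - b))"
  by (simp add: qbinom_def flip: of_nat_diff)

lemma qbinom_neg: "b < 0 \<Longrightarrow> qbinom q a b = 0"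
  by (simp add: qbinom_def)

lemma qbinom_add: "qbinom q (k + m) (int m) = (\<Prod>l<m. qint q (Suc k + l)) / (\<Prod>l<m. qint q (Suc l))"
proof -
  have "qpoch q m = (\<Prod>l<m. 1 - q ^ Suc l)"
    using qpoch_add[of 0 m] by simp
  then show ?thesis
    using one_minus_q by (simp add: qbinom_int qpoch_add prod_qint)
qed

lemma qbinom_0 [simp]: "qbinom q a 0 = 1"
  by (simp add: qbinom_def)

text \<open>The second half of the \<open>2 * m\<close> numerator factors cancels against the second
  denominator window, leaving a q-binomial.\<close>

lemma closed_form_1: "closed_form q (Suc 0) m k = q ^ (m choose 2) * qbinom q (k + m) (int m)"
  by (simp add: closed_form_def closed_form_factor_def qbinom_add prod_lessThan_double prod.distrib add_ac)

lemma qcatalan_conv: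
  "qcatalan q (Suc k) (int n)
    = (1 - q ^ Suc k) * qpoch q (2 * n + k) / (qpoch q n * qpoch q (n + k + 1))"
proof -
  have "1 - q ^ Suc (2 * n + k) \<noteq> 0"
    using not_root_of_unity[of "Suc (2 * n + k)"] by simp
  then show ?thesis
    using one_minus_q by (simp add: qcatalan_def qbinom_int qint_def qpoch_Suc)
qed

text \<open>Holds since \<open>closed_form_factor q n 1 k\<close> is the ratio of consecutive
  q-Catalan numbers.\<close>

lemma closed_form_eq_qcatalan: "closed_form q n (Suc 0) k = qcatalan q (Suc k) (int n)"
proof (induction n)
  case 0
  then show ?case
    using not_root_of_unity[of "Suc k"] by (simp only: qcatalan_conv) (simp add: qpoch_Suc)
next
  case (Suc n)
  have nz: "1 - q ^ Suc n \<noteq> 0" "1 - q ^ Suc (Suc (n + k)) \<noteq> 0"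
    using not_root_of_unity[of "Suc n"] not_root_of_unity[of "Suc (Suc (n + k))"] by simp_all
  have "closed_form_factor q n (Suc 0) k = qint q (Suc (2 * n + k)) * qint q (Suc (Suc (2 * n + k)))
      / (qint q (Suc n) * qint q (Suc (Suc (n + k))))"
    by (simp add: closed_form_factor_def eval_nat_numeral)
  also have "\<dots> = (1 - q ^ Suc (2 * n + k)) * (1 - q ^ Suc (Suc (2 * n + k)))
      / ((1 - q ^ Suc n) * (1 - q ^ Suc (Suc (n + k))))"
    using one_minus_q nz by (simp add: qint_def)
  finally have r: "closed_form_factor q n (Suc 0) k = \<dots>" .
  have p: "qpoch q (2 * Suc n + k)
      = qpoch q (2 * n + k) * (1 - q ^ Suc (2 * n + k)) * (1 - q ^ Suc (Suc (2 * n + k)))"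
    by (simp add: qpoch_Suc)
  have p': "qpoch q (Suc n + k + 1) = qpoch q (n + k + 1) * (1 - q ^ Suc (Suc (n + k)))"
    by (simp add: qpoch_Suc)
  show ?case
    unfolding closed_form_Suc Suc qcatalan_conv r p p' qpoch_Suc[of n]
    by (simp add: numeral_2_eq_2 mult_ac)
qed

section \<open>Evaluation of both determinants by condensation\<close>

lemma det_band:
  "det (mat n n (\<lambda>(i, j). q powi binom2 (int i - int j + int m)
      * qbinom q (k + i + j + m) (int i - int j + int m))) = closed_form q n m k"
proof (induction n arbitrary: m k rule: induct_nat_012)
  case 1
  then show ?case
    by (subst det_single) (simp_all add: closed_form_1 binom2_int)
next
  case (ge2 n)
  show ?case
  proof (cases m)
    \<comment> \<open>The recurrence would require \<open>m - 1\<close>. Here the matrix is lower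
      triangular with unit diagonal, as q-binomials with negative lower index vanish.\<close>
    case 0
    have "det (mat (Suc (Suc n)) (Suc (Suc n)) (\<lambda>(i, j). q powi binom2 (int i - int j)
      * qbinom q (k + i + j) (int i - int j))) = 1"
      by (subst det_lower_triangular[where n = "Suc (Suc n)"])
        (auto simp: qbinom_neg prod_list_diag_prod binom2_def)
    then show ?thesis using 0 by simp
  next
    case (Suc r)
    let ?f = "\<lambda>m k i j. q powi binom2 (int i - int j + int m)
      * qbinom q (k + i + j + m) (int i - int j + int m)"
    \<comment> \<open>A row shift raises \<open>m\<close>; a column shift lowers \<open>m\<close>
      and raises \<open>k\<close> by 2; both together only raise \<open>k\<close> by 2.\<close>
    have "?f (Suc r) k (Suc i) (Suc j) = ?f (Suc r) (k + 2) i j"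
      "?f (Suc r) k (Suc i) j = ?f (Suc (Suc r)) k i j"
      "?f (Suc r) k i (Suc j) = ?f r (k + 2) i j" for i j
      by (simp_all add: add_ac algebra_simps)
    then have "det (mat (Suc (Suc n)) (Suc (Suc n)) (\<lambda>(i, j). ?f m k i j)) * closed_form q n m (k + 2)
       = closed_form q (Suc n) (Suc r) k * closed_form q (Suc n) (Suc r) (k + 2)
       - closed_form q (Suc n) (Suc (Suc r)) k * closed_form q (Suc n) r (k + 2)"
      using desnanot_jacobi[of n "?f m k"] by (simp only: Suc ge2)
    also have "\<dots> = closed_form q (Suc (Suc n)) m k * closed_form q n m (k + 2)"
      using closed_form_recurrence[of n r k] by (simp add: Suc algebra_simps)
    finally show ?thesis by simp
  qed
qed simp

lemma det_qcatalan:
  "det (mat m m (\<lambda>(i, j). qcatalan q (2 * i + k + 1) (int n - int i + int j))) = closed_form q n m k"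
proof (induction m arbitrary: n k rule: induct_nat_012)
  case 1
  then show ?case
    by (subst det_single) (simp_all add: closed_form_eq_qcatalan)
next
  case (ge2 m)
  show ?case
  proof (cases n)
    \<comment> \<open>Upper triangular with unit diagonal, since q-Catalan numbers of negative index
      vanish.\<close>
    case 0
    have "det (mat (Suc (Suc m)) (Suc (Suc m)) (\<lambda>(i, j). qcatalan q (2 * i + k + 1) (- int i + int j))) = 1"
      by (subst det_upper_triangular[where n = "Suc (Suc m)"])
        (auto simp: qcatalan_def prod_list_diag_prod)
    then show ?thesis using 0 by simp
  next
    case (Suc r)
    let ?f = "\<lambda>n k i j. qcatalan q (2 * i + k + 1) (int n - int i + int j)"
    \<comment> \<open>Here \<open>m\<close> is the size and \<open>n\<close> the shifted parameter:
      a row shift lowers \<open>n\<close> and raises \<open>k\<close> by 2, a column shift raises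
      \<open>n\<close>.\<close>
    have "?f (Suc r) k (Suc i) (Suc j) = ?f (Suc r) (k + 2) i j"
      "?f (Suc r) k (Suc i) j = ?f r (k + 2) i j"
      "?f (Suc r) k i (Suc j) = ?f (Suc (Suc r)) k i j" for i j
      by (simp_all add: add_ac algebra_simps)
    then have "det (mat (Suc (Suc m)) (Suc (Suc m)) (\<lambda>(i, j). ?f n k i j)) * closed_form q n m (k + 2)
       = closed_form q (Suc r) (Suc m) k * closed_form q (Suc r) (Suc m) (k + 2)
       - closed_form q r (Suc m) (k + 2) * closed_form q (Suc (Suc r)) (Suc m) k"
      using desnanot_jacobi[of m "?f n k"] by (simp only: Suc ge2)
    also have "\<dots> = closed_form q n (Suc (Suc m)) k * closed_form q n m (k + 2)"
      using closed_form_recurrence[of r m k] by (simp add: Suc algebra_simps)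
    finally show ?thesis by simp
  qed
qed simp

lemma closed_form_product:
  "q powi (int n * binom2 (int m)) *
       (\<Prod>j=1..n. (\<Prod>l<2*m. qint q (2*j - 1 + k + l)) /
                   (\<Prod>l<m. qint q (j + l) * qint q (j + k + m + l))) = closed_form q n m k"
  by (simp add: closed_form_def closed_form_factor_def binom2_int prod.atLeast1_atMost_eq
      flip: of_nat_mult)

end

section \<open>Specialization to the indeterminate\<close>

lemma qq_power: "qq ^ a = Fract ([:0, 1:] ^ a) 1"
  by (induction a) (simp_all add: qq_def One_fract_def)

interpretation qq: generic_q qq
proof
  show "qq \<noteq> 0"
    by (simp add: qq_def Zero_fract_def eq_fract)
  show "qq ^ a \<noteq> 1" if "0 < a" for a
  proof
    assume "qq ^ a = 1"
    then have "[:0, 1:] ^ a = (1 :: rat poly)"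
      by (simp add: qq_power One_fract_def eq_fract)
    then have "degree ([:0, 1:] ^ a :: rat poly) = 0" by simp
    then show False using that by (simp add: degree_linear_power)
  qed
qed

theorem theorem10:
  fixes n m k :: nat
  shows
    "det (mat n n (\<lambda>(i, j).
        qq powi binom2 (int i - int j + int m)
          * qbinom qq (k + i + j + m) (int i - int j + int m)))
     = qq powi (int n * binom2 (int m)) *
       (\<Prod>j=1..n. (\<Prod>l<2*m. qint qq (2*j - 1 + k + l)) /
                   (\<Prod>l<m. qint qq (j + l) * qint qq (j + k + m + l)))
     \<and>
     qq powi (int n * binom2 (int m)) *
       (\<Prod>j=1..n. (\<Prod>l<2*m. qint qq (2*j - 1 + k + l)) /
                   (\<Prod>l<m. qint qq (j + l) * qint qq (j + k + m + l)))
     = det (mat m m (\<lambda>(i, j). qcatalan qq (2*i + k + 1) (int n - int i + int j)))"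
  by (simp only: qq.det_band qq.det_qcatalan qq.closed_form_product)

end
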